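(* Let $L$ satisfy the structured-inverse hypothesis (see context) on a $p$-dimensional subspace $\mathcal U\subseteq\mathbb{R}^n$, and let $Z_\star\in\mathbb{R}^{n\times\ell}$ be arbitrary. If $p-k=1$ and $k\ge\ell+1$, then every second-order critical point $Z\in\mathbb{R}^{n\times k}$ of the problem $\min_{Z\in\mathbb{R}^{n\times k}}g(Z;Z_\star)$ is globally optimal, i.e. a global minimizer of $g(\cdot;Z_\star)$.
   Context: Let $n,k,\ell\ge1$ be integers. Matrix spaces carry the Frobenius inner product $\langle X,Y\rangle=\mathrm{Tr}(X^\top Y)$. $\mathrm{Sym}(n)$ is the space of real symmetric $n\times n$ matrices. Let $\mathcal U\subseteq\mathbb{R}^n$ be a linear subspace of dimension $p$ with orthogonal projector $P_{\mathcal U}$, and $\mathrm{Sym}(\mathcal U)=\{Y\in\mathrm{Sym}(n):Y=P_{\mathcal U}YP_{\mathcal U}\}$. Let $L:\mathrm{Sym}(\mathcal U)\to\mathrm{Sym}(\mathcal U)$ be linear, self-adjoint and positive definite, extended to $\mathrm{Sym}(n)$ by $L(X):=L(P_{\mathcal U}XP_{\mathcal U})$. Structured-inverse hypothesis: there are vectors $a_1,\ldots,a_N\in\mathcal U$ ($N=0$ allowed) and a constant $\eta\in(0,1]$ such that (F1) $\sum_{i=1}^N a_ia_i^\top\preceq P_{\mathcal U}$; (F2) $\|a_i\|^2\le 1-\eta$ for all $i$; (F3) $L^{-1}=I-\Gamma$ on $\mathrm{Sym}(\mathcal U)$, where $\Gamma(X)=\sum_{i=1}^N a_ia_i^\top\,(a_i^\top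 Xa_i)$. Objective: for $Z\in\mathbb{R}^{n\times k}$ and $Z_\star\in\mathbb{R}^{n\times\ell}$, with $Y=ZZ^\top$ and $Y_\star=Z_\star Z_\star^\top$, $g(Z;Z_\star)=\langle Y-Y_\star,L(Y-Y_\star)\rangle$. Criticality: let $S=L(Y_\star-Y)$. $Z$ is first-order critical if $SZ=0$. $Z$ is second-order critical if in addition $0\le-\langle\dot Z\dot Z^\top,S\rangle+\frac12\langle\dot Y,L\dot Y\rangle$ for all $\dot Z\in\mathbb{R}^{n\times k}$, where $\dot Y=Z\dot Z^\top+\dot ZZ^\top$. (These are equivalent to vanishing gradient and positive semidefinite Hessian of $g(\cdot;Z_\star)$.) *)

theory Defs
  imports "HOL-Analysis.Analysis"
begin

definition frob :: "real^'k^'n \<Rightarrow> real^'k^'n \<Rightarrow> real" where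
  "frob X Y = trace (transpose X ** Y)"

lemma frob_eq_inner: "frob X Y = X \<bullet> Y"
proof -
  have "frob X Y = (\<Sum>j\<in>UNIV. \<Sum>i\<in>UNIV. X$i$j * Y$i$j)"
    by (simp add: frob_def trace_def matrix_matrix_mult_def transpose_def)
  also have "\<dots> = (\<Sum>i\<in>UNIV. \<Sum>j\<in>UNIV. X$i$j * Y$i$j)"
    by (rule sum.swap)
  finally show ?thesis
    by (simp add: inner_vec_def)
qed

definition symmetric_mat :: "real^'n^'n \<Rightarrow> bool" where
  "symmetric_mat A \<longleftrightarrow> transpose A = A"

definition loewner_le :: "real^'n^'n \<Rightarrow> real^'n^'n \<Rightarrow> bool" (infix "\<preceq>" 50) where
  "A \<preceq> B \<longleftrightarrow> symmetric_mat (B - A) \<and> (\<forall>x. 0 \<le> x \<bullet> ((B - A) *v x))"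

definition outer :: "real^'n \<Rightarrow> real^'m \<Rightarrow> real^'m^'n" where
  "outer a b = (\<chi> i j. a$i * b$j)"

lemma outer_mult_vec: "outer a b *v x = (b \<bullet> x) *\<^sub>R a"
  by (simp add: vec_eq_iff outer_def matrix_vector_mult_def inner_vec_def
      sum_distrib_left mult_ac)

definition is_orth_projector :: "real^'n^'n \<Rightarrow> (real^'n) set \<Rightarrow> bool" where
  "is_orth_projector P U \<longleftrightarrow> P ** P = P \<and> transpose P = P \<and> range ((*v) P) = U"

text \<open>For a linear subspace \<open>U\<close> the description below determines a unique matrix
  (lemma \<open>ex1_orth_projector\<close>).\<close>
definition orth_projector :: "(real^'n) set \<Rightarrow> real^'n^'n" where
  "orth_projector U = (THE P. is_orth_projector P U)"

lemma ex_orth_projector: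
  fixes U :: "(real^'n) set"
  assumes "subspace U"
  shows "\<exists>P. is_orth_projector P U"
proof -
  obtain B where B: "B \<subseteq> U" "pairwise orthogonal B" "\<And>x. x \<in> B \<Longrightarrow> norm x = 1"
    "independent B" "span B = U"
    using orthonormal_basis_subspace[OF assms] by metis
  have fin: "finite B" using B(4) by (rule independent_imp_finite)
  define P where "P = (\<Sum>b\<in>B. outer b b)"
  have sumv: "(\<Sum>b\<in>A. outer b b) *v x = (\<Sum>b\<in>A. (b \<bullet> x) *\<^sub>R b)"
    if "finite A" for A and x :: "real^'n"
    using that by (induction A rule: finite_induct)
      (auto simp: matrix_vector_mult_add_rdistrib outer_mult_vec)
  have Pv: "P *v x = (\<Sum>b\<in>B. (b \<bullet> x) *\<^sub>R b)" for x
    unfolding P_def by (rule sumv[OF fin])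
  have inU: "P *v x \<in> U" for x
    unfolding Pv using B(1) by (intro subspace_sum[OF assms] subspace_scale[OF assms]) auto
  have basis: "P *v c = c" if c: "c \<in> B" for c
  proof -
    have "P *v c = (\<Sum>b\<in>B. if b = c then c else 0)"
      unfolding Pv
    proof (rule sum.cong)
      fix b assume b: "b \<in> B"
      show "(b \<bullet> c) *\<^sub>R b = (if b = c then c else 0)"
      proof (cases "b = c")
        case True
        then show ?thesis using B(3)[OF c] by (simp add: dot_square_norm)
      next
        case False
        then have "orthogonal b c" using B(2) b c by (auto simp: pairwise_def)
        then show ?thesis using False by (simp add: orthogonal_def)
      qed
    qed simp
    also have "\<dots> = c" using c fin by simp
    finally show ?thesis .
  qed
  have fixU: "P *v u = u" if "u \<in> U" for u
  proof -
    have "u \<in> span B" using that B(5) by simp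
    then show ?thesis
      by (induction rule: span_induct_alt)
        (simp_all add: matrix_vector_right_distrib matrix_vector_mult_scaleR basis)
  qed
  have "P ** P = P"
    by (simp add: matrix_eq matrix_vector_mul_assoc[symmetric] fixU inU)
  moreover have "transpose P = P"
    by (simp add: P_def transpose_def vec_eq_iff outer_def mult.commute)
  moreover have "range ((*v) P) = U"
    using inU fixU by (metis image_subset_iff rangeI subsetI subset_antisym)
  ultimately show ?thesis unfolding is_orth_projector_def by blast
qed

lemma orth_projector_unique:
  fixes U :: "(real^'n) set"
  assumes "is_orth_projector P U" "is_orth_projector Q U"
  shows "P = Q"
proof -
  have absorb: "A ** C = C" if "is_orth_projector A U" "is_orth_projector C U" for A C :: "real^'n^'n"
  proof -
    have "A *v u = u" if "u \<in> U" for u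
      using that \<open>is_orth_projector A U\<close> unfolding is_orth_projector_def
      by (metis imageE matrix_vector_mul_assoc)
    moreover have "C *v x \<in> U" for x
      using \<open>is_orth_projector C U\<close> unfolding is_orth_projector_def by blast
    ultimately show ?thesis
      by (simp add: matrix_eq matrix_vector_mul_assoc[symmetric])
  qed
  have "P = transpose P" using assms(1) by (simp add: is_orth_projector_def)
  also have "\<dots> = transpose (Q ** P)" using absorb[OF assms(2,1)] by simp
  also have "\<dots> = P ** Q" using assms by (simp add: matrix_transpose_mul is_orth_projector_def)
  also have "\<dots> = Q" using absorb[OF assms] .
  finally show ?thesis .
qed

lemma ex1_orth_projector: "subspace U \<Longrightarrow> \<exists>!P. is_orth_projector P U"
  using ex_orth_projector orth_projector_unique by blast

lemma orth_projector: "subspace U \<Longrightarrow> is_orth_projector (orth_projector U) U"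
  unfolding orth_projector_def by (rule theI'[OF ex1_orth_projector])

definition Sym_on :: "(real^'n) set \<Rightarrow> (real^'n^'n) set" where
  "Sym_on U = {Y. symmetric_mat Y \<and> Y = orth_projector U ** Y ** orth_projector U}"

text \<open>An operator on the space \<open>Sym_on U\<close> is modelled by a total function whose values
  outside \<open>Sym_on U\<close> are irrelevant.\<close>
definition linear_op_on :: "(real^'n) set \<Rightarrow> (real^'n^'n \<Rightarrow> real^'n^'n) \<Rightarrow> bool" where
  "linear_op_on U L \<longleftrightarrow>
     (\<forall>X\<in>Sym_on U. L X \<in> Sym_on U) \<and>
     (\<forall>X\<in>Sym_on U. \<forall>Y\<in>Sym_on U. L (X + Y) = L X + L Y) \<and>
     (\<forall>c. \<forall>X\<in>Sym_on U. L (c *\<^sub>R X) = c *\<^sub>R L X)"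

definition self_adjoint_on :: "(real^'n) set \<Rightarrow> (real^'n^'n \<Rightarrow> real^'n^'n) \<Rightarrow> bool" where
  "self_adjoint_on U L \<longleftrightarrow> (\<forall>X\<in>Sym_on U. \<forall>Y\<in>Sym_on U. frob X (L Y) = frob (L X) Y)"

definition pos_def_on :: "(real^'n) set \<Rightarrow> (real^'n^'n \<Rightarrow> real^'n^'n) \<Rightarrow> bool" where
  "pos_def_on U L \<longleftrightarrow> (\<forall>X\<in>Sym_on U. X \<noteq> 0 \<longrightarrow> 0 < frob X (L X))"

definition ext_op ::
  "(real^'n) set \<Rightarrow> (real^'n^'n \<Rightarrow> real^'n^'n) \<Rightarrow> real^'n^'n \<Rightarrow> real^'n^'n" where
  "ext_op U L X = L (orth_projector U ** X ** orth_projector U)"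

definition Gamma_op :: "nat \<Rightarrow> (nat \<Rightarrow> real^'n) \<Rightarrow> real^'n^'n \<Rightarrow> real^'n^'n" where
  "Gamma_op N a X = (\<Sum>i=1..N. (a i \<bullet> (X *v a i)) *\<^sub>R outer (a i) (a i))"

text \<open>\<open>inv_into (Sym_on U) L\<close> is the two-sided inverse of \<open>L\<close> on \<open>Sym_on U\<close>, since a linear
  positive definite \<open>L\<close> is a bijection of this finite-dimensional space.\<close>
definition structured_inverse :: "(real^'n) set \<Rightarrow> (real^'n^'n \<Rightarrow> real^'n^'n) \<Rightarrow> bool" where
  "structured_inverse U L \<longleftrightarrow>
     (\<exists>(N::nat) a (\<eta>::real). 0 < \<eta> \<and> \<eta> \<le> 1 \<and>
        (\<forall>i\<in>{1..N}. a i \<in> U) \<and>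
        (\<Sum>i=1..N. outer (a i) (a i)) \<preceq> orth_projector U \<and>
        (\<forall>i\<in>{1..N}. (norm (a i))\<^sup>2 \<le> 1 - \<eta>) \<and>
        (\<forall>X\<in>Sym_on U. inv_into (Sym_on U) L X = X - Gamma_op N a X))"

definition objective ::
  "(real^'n) set \<Rightarrow> (real^'n^'n \<Rightarrow> real^'n^'n) \<Rightarrow> real^'l^'n \<Rightarrow> real^'k^'n \<Rightarrow> real" where
  "objective U L Zs Z =
     (let D = Z ** transpose Z - Zs ** transpose Zs in frob D (ext_op U L D))"

definition slack ::
  "(real^'n) set \<Rightarrow> (real^'n^'n \<Rightarrow> real^'n^'n) \<Rightarrow> real^'l^'n \<Rightarrow> real^'k^'n \<Rightarrow> real^'n^'n" where
  "slack U L Zs Z = ext_op U L (Zs ** transpose Zs - Z ** transpose Z)"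

definition first_order_critical ::
  "(real^'n) set \<Rightarrow> (real^'n^'n \<Rightarrow> real^'n^'n) \<Rightarrow> real^'l^'n \<Rightarrow> real^'k^'n \<Rightarrow> bool" where
  "first_order_critical U L Zs Z \<longleftrightarrow> slack U L Zs Z ** Z = 0"

definition second_order_critical ::
  "(real^'n) set \<Rightarrow> (real^'n^'n \<Rightarrow> real^'n^'n) \<Rightarrow> real^'l^'n \<Rightarrow> real^'k^'n \<Rightarrow> bool" where
  "second_order_critical U L Zs Z \<longleftrightarrow>
     first_order_critical U L Zs Z \<and>
     (\<forall>V :: real^'k^'n.
        let Yd = Z ** transpose V + V ** transpose Z in
        0 \<le> - frob (V ** transpose V) (slack U L Zs Z) + 1/2 * frob Yd (ext_op U L Yd))"

end

theory Submission
  imports Defs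
begin

text \<open>
  If the slack \<open>S\<close> is negative semidefinite, convexity in \<open>Y\<close> gives optimality. Otherwise testing
  curvature on \<open>V = x w\<^sup>T\<close> forces \<open>Z\<close> (projected to \<open>U\<close>) to have full column rank, so its range is a
  hyperplane \<open>u\<^sup>\<bottom>\<close> of \<open>U\<close> and \<open>S = \<mu> u u\<^sup>T\<close> with \<open>\<mu> > 0\<close>. The structured inverse then gives
  \<open>Y\<^sub>\<star> - Y = \<mu> (u u\<^sup>T - T)\<close> on \<open>U\<close>, where \<open>T = \<Sum> (a\<^sub>i\<bullet>u)\<^sup>2 a\<^sub>i a\<^sub>i\<^sup>T\<close>. For \<open>x\<close> in the kernel of \<open>Y\<^sub>\<star>\<close>, which has
  dimension at least two in \<open>U\<close>, the direction \<open>V\<close> with \<open>L(Z V\<^sup>T + V Z\<^sup>T) = u x\<^sup>T + x u\<^sup>T\<close> yields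
  \<open>3 x\<bullet>Tx \<ge> |x|\<^sup>2 + 2 (u\<bullet>x)\<^sup>2\<close>. Tracing this over a plane and using Bessel's inequality for the \<open>a\<^sub>i\<close>
  leaves an inequality between the weights \<open>s\<^sub>i = (a\<^sub>i\<bullet>u)\<^sup>2\<close> and the squared lengths \<open>t\<^sub>i\<close> of the components
  of \<open>a\<^sub>i\<close> in the plane orthogonal to \<open>u\<close>, which contradicts
  \<open>\<Sum> s\<^sub>i\<^sup>3 - B\<^sup>2 + (1 - B)(\<Sum> s\<^sub>i t\<^sub>i - 2/3) < 0\<close>, \<open>B = \<Sum> s\<^sub>i\<^sup>2\<close>.
\<close>

section \<open>An inequality for frame weights\<close>

text \<open>For \<open>s + t \<le> 1\<close> the product \<open>s t\<close> lies below
  \<open>(1 - \<kappa>)\<^sup>2 s + \<kappa>\<^sup>2 t\<close>, touching it at \<open>(\<kappa>, 1 - \<kappa>)\<close>. Both sides below are affine in \<open>t\<close>, so it suffices to compare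
  them at \<open>t = 0\<close> and \<open>t = 1 - s\<close>.\<close>
lemma tangent_bound_rest:
  fixes s t \<kappa> D :: real
  assumes "0 \<le> s" "0 \<le> t" "s + t \<le> 1" "s < 1" "s \<le> D" "(s - \<kappa>)\<^sup>2 \<le> D * (1 - \<kappa>)\<^sup>2"
  shows "s * (s - \<kappa>)\<^sup>2 \<le> D * ((1 - \<kappa>)\<^sup>2 * s + \<kappa>\<^sup>2 * t - s * t)"
proof -
  have "(1 - s) * (D * ((1 - \<kappa>)\<^sup>2 * s + \<kappa>\<^sup>2 * t - s * t) - s * (s - \<kappa>)\<^sup>2)
      = (1 - s - t) * (s * (D * (1 - \<kappa>)\<^sup>2 - (s - \<kappa>)\<^sup>2)) + t * ((D - s) * (s - \<kappa>)\<^sup>2)"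
    by algebra
  moreover have "0 \<le> (1 - s - t) * (s * (D * (1 - \<kappa>)\<^sup>2 - (s - \<kappa>)\<^sup>2))"
    using assms by (intro mult_nonneg_nonneg) auto
  moreover have "0 \<le> t * ((D - s) * (s - \<kappa>)\<^sup>2)"
    using assms by (intro mult_nonneg_nonneg) auto
  ultimately have "0 \<le> (1 - s) * (D * ((1 - \<kappa>)\<^sup>2 * s + \<kappa>\<^sup>2 * t - s * t) - s * (s - \<kappa>)\<^sup>2)"
    by linarith
  then show ?thesis using assms(4) by (simp add: zero_le_mult_iff)
qed

text \<open>The largest weight may exceed \<open>D\<close>, and then the tangent inequality can fail
  at \<open>t = 1 - s\<close>, where the two sides differ by exactly
  \<open>(D - s) * (s - 1/3)\<^sup>2\<close>. The \<open>min\<close> term records this loss.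
  Strictness comes from the end \<open>t = 0\<close>, which carries the positive factor
  \<open>1 - s - t\<close>.\<close>

lemma tangent_bound_max:
  fixes s t D :: real
  assumes "0 < s" "0 \<le> t" "s + t < 1" "0 < D" "(3 * s - 1)\<^sup>2 < 4 * D"
  shows "s * (s - 1/3)\<^sup>2 + min 0 ((D - s) * (s - 1/3)\<^sup>2) < D * (4/9 * s + 1/9 * t - s * t)"
proof -
  define f where "f = D * (4/9 * s + 1/9 * t - s * t) - s * (s - 1/3)\<^sup>2"
  define m where "m = min 0 ((D - s) * (s - 1/3)\<^sup>2)"
  have "(1 - s) * f
      = (1 - s - t) * (s * (4 * D - (3 * s - 1)\<^sup>2) / 9) + t * ((D - s) * (s - 1/3)\<^sup>2)"
    unfolding f_def by (simp add: field_simps power2_eq_square)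
  moreover have "0 < (1 - s - t) * (s * (4 * D - (3 * s - 1)\<^sup>2) / 9)"
    using assms by simp
  moreover have "t * m \<le> t * ((D - s) * (s - 1/3)\<^sup>2)"
    unfolding m_def using assms by (intro mult_left_mono) auto
  moreover have "(1 - s) * m \<le> t * m"
    using assms unfolding m_def by (intro mult_right_mono_neg) auto
  ultimately have "(1 - s) * m < (1 - s) * f" by linarith
  then have "m < f" using assms by simp
  then show ?thesis unfolding m_def f_def by linarith
qed

text \<open>The supremum \<open>0\<close> is approached at three weights \<open>s\<^sub>i = 1/3\<close>, \<open>t\<^sub>i = 2/3\<close>. If the largest weight \<open>x\<close> is
  at most \<open>317/500\<close>, the tangent at \<open>1/3\<close> is used for all indices; otherwise the tangent at
  \<open>(1 - x)/2\<close> is used for all but the largest. Any threshold between about \<open>0.633\<close> and \<open>0.64\<close>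
  would do.\<close>
lemma frame_weight_inequality:
  fixes s t :: "'i \<Rightarrow> real"
  assumes fin: "finite I" and s0: "\<And>i. i \<in> I \<Longrightarrow> 0 \<le> s i" and t0: "\<And>i. i \<in> I \<Longrightarrow> 0 \<le> t i"
    and st: "\<And>i. i \<in> I \<Longrightarrow> s i + t i < 1"
    and sums: "(\<Sum>i\<in>I. s i) \<le> 1" and sumt: "(\<Sum>i\<in>I. t i) \<le> 2"
  shows "(\<Sum>i\<in>I. (s i)^3) - (\<Sum>i\<in>I. (s i)\<^sup>2)\<^sup>2
    + (1 - (\<Sum>i\<in>I. (s i)\<^sup>2)) * ((\<Sum>i\<in>I. s i * t i) - 2/3) < 0"
proof (cases "\<forall>i\<in>I. s i = 0")
  case True
  then show ?thesis by simp
next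
  case False
  then have "I \<noteq> {}" by auto
  then have "Max (s ` I) \<in> s ` I" using fin by simp
  then obtain j where j: "j \<in> I" and "s j = Max (s ` I)" by auto
  then have jmax: "s i \<le> s j" if "i \<in> I" for i using fin that by simp
  define x where "x = s j"
  have x0: "0 < x" using False s0 jmax unfolding x_def by force
  have x1: "x + t j < 1" "0 \<le> t j" "x < 1" using st[OF j] t0[OF j] by (auto simp: x_def)
  define R where "R = I - {j}"
  have split: "sum g I = g j + sum g R" for g :: "'i \<Rightarrow> real"
    unfolding R_def using fin j by (rule sum.remove)
  have RI: "i \<in> I" "i \<noteq> j" if "i \<in> R" for i using that unfolding R_def by auto
  define \<sigma> where "\<sigma> = (\<Sum>i\<in>R. s i)"
  define \<theta> where "\<theta> = (\<Sum>i\<in>R. t i)"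
  define m where "m = (\<Sum>i\<in>R. (s i)\<^sup>2)"
  define c where "c = (\<Sum>i\<in>R. (s i)^3)"
  define h where "h = (\<Sum>i\<in>R. s i * t i)"
  have \<sigma>: "\<sigma> \<le> 1 - x" using sums split[of s] by (simp add: \<sigma>_def x_def)
  have \<theta>: "\<theta> \<le> 2 - t j" using sumt split[of t] by (simp add: \<theta>_def)
  have m0: "0 \<le> m" "0 \<le> \<sigma>" unfolding m_def \<sigma>_def by (auto intro!: sum_nonneg simp: s0 RI)
  have sR: "s i \<le> 1 - x" if "i \<in> R" for i
  proof -
    have "s i \<le> \<sigma>" unfolding \<sigma>_def using fin that
      by (intro member_le_sum) (auto simp: R_def s0)
    then show ?thesis using \<sigma> by simp
  qed
  define D where "D = 1 - x\<^sup>2 - m"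
  \<comment> \<open>The resulting bound \<open>1 - x \<le> D\<close> is what gives
    \<open>s i \<le> D\<close> for every index but \<open>j\<close>, so that
    \<open>tangent_bound_rest\<close> applies to those indices.\<close>
  have "m \<le> x * \<sigma>" unfolding m_def \<sigma>_def sum_distrib_left
    by (intro sum_mono) (auto simp: power2_eq_square x_def intro!: mult_right_mono s0 jmax RI)
  also have "\<dots> \<le> x * (1 - x)" using \<sigma> x0 by (intro mult_left_mono) auto
  finally have Dx: "1 - x \<le> D" unfolding D_def by (simp add: power2_eq_square algebra_simps)
  then have D0: "0 < D" using x1 by simp
  have goal: "?thesis \<longleftrightarrow> x^3 + c - (x\<^sup>2 + m)\<^sup>2 + D * (x * t j + h - 2/3) < 0"
    by (simp add: split x_def m_def c_def h_def D_def algebra_simps)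
  have rest: "c - 2 * \<kappa> * m + \<kappa>\<^sup>2 * \<sigma> \<le> D * ((1 - \<kappa>)\<^sup>2 * \<sigma> + \<kappa>\<^sup>2 * \<theta> - h)"
    if \<kappa>: "\<And>i. i \<in> R \<Longrightarrow> (s i - \<kappa>)\<^sup>2 \<le> D * (1 - \<kappa>)\<^sup>2" for \<kappa>
  proof -
    have "c - 2 * \<kappa> * m + \<kappa>\<^sup>2 * \<sigma> = (\<Sum>i\<in>R. s i * (s i - \<kappa>)\<^sup>2)"
      unfolding c_def m_def \<sigma>_def sum_distrib_left sum_subtractf[symmetric] sum.distrib[symmetric]
      by (intro sum.cong) (auto simp: power2_eq_square power3_eq_cube algebra_simps)
    also have "\<dots> \<le> (\<Sum>i\<in>R. D * ((1 - \<kappa>)\<^sup>2 * s i + \<kappa>\<^sup>2 * t i - s i * t i))"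
    proof (intro sum_mono tangent_bound_rest)
      fix i assume i: "i \<in> R"
      note ii = RI(1)[OF i]
      show "0 \<le> s i" "0 \<le> t i" "s i + t i \<le> 1" "s i < 1"
        using s0[OF ii] t0[OF ii] st[OF ii] by auto
      show "s i \<le> D" using sR[OF i] Dx by simp
      show "(s i - \<kappa>)\<^sup>2 \<le> D * (1 - \<kappa>)\<^sup>2" using \<kappa>[OF i] .
    qed
    also have "\<dots> = D * ((1 - \<kappa>)\<^sup>2 * \<sigma> + \<kappa>\<^sup>2 * \<theta> - h)"
      unfolding \<sigma>_def \<theta>_def h_def
      by (simp add: sum_distrib_left sum_subtractf[symmetric] sum.distrib[symmetric])
    finally show ?thesis .
  qed
  show ?thesis
  proof (cases "x \<le> 317/500")
    case True
    define b where "b = x\<^sup>2 + m"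
    have Db: "D = 1 - b" by (simp add: D_def b_def)
    have D3: "D \<ge> 183/500" using Dx True by simp
    have sq: "(3 * y - 1)\<^sup>2 \<le> 1" if "0 \<le> y" "y \<le> 317/500" for y :: real
      using that abs_square_le_1[of "3*y-1"] by auto
    have r: "c - 2/3 * m + \<sigma>/9 \<le> D * (4/9 * \<sigma> + \<theta>/9 - h)"
    proof -
      have "(s i - 1/3)\<^sup>2 \<le> D * (1 - 1/3)\<^sup>2" if "i \<in> R" for i
        using sq[of "s i"] s0[OF RI(1)[OF that]] jmax[OF RI(1)[OF that]] True D3
        by (simp add: x_def power2_eq_square algebra_simps)
      from rest[OF this] show ?thesis by (simp add: power2_eq_square)
    qed
    define \<mu> where "\<mu> = min 0 ((D - x) * (x - 1/3)\<^sup>2)"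
    have mx: "x * (x - 1/3)\<^sup>2 + \<mu> < D * (4/9 * x + 1/9 * t j - x * t j)"
      unfolding \<mu>_def using sq[of x] x0 x1 True D0 D3 by (intro tangent_bound_max) auto
    \<comment> \<open>Adding \<open>r\<close> and \<open>mx\<close> and using the bounds on the sums
      leaves \<open>- \<mu> - (b - 1/3)\<^sup>2\<close> as an upper bound for the target. The square
      thus has to pay for the loss \<open>- \<mu>\<close> at the largest weight.\<close>
    have key: "- \<mu> \<le> (b - 1/3)\<^sup>2"
    proof (cases "x \<le> D")
      case True
      then show ?thesis by (simp add: \<mu>_def)
    next
      case False
      have x12: "1/3 \<le> x" using False D3 by simp
      have "(x - D) * (x - 1/3)\<^sup>2 \<le> (317/500 - 1 + b) * (317/500 - 1/3)\<^sup>2"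
        using False True x12 Db by (intro mult_mono power_mono) auto
      also have "\<dots> \<le> (b - 1/3)\<^sup>2"
      proof -
        \<comment> \<open>The square is completed in \<open>b\<close>. The sign of the remaining
          constant is what limits the threshold on \<open>x\<close> from above.\<close>
        define v :: real where "v = (317/500 - 1/3)\<^sup>2"
        have "(b - 1/3)\<^sup>2 - (317/500 - 1 + b) * v
            = (b - (1/3 + v/2))\<^sup>2 + ((1 - 317/500 - 1/3) * v - v\<^sup>2/4)"
          by (simp add: power2_eq_square field_simps)
        moreover have "0 \<le> (1 - 317/500 - 1/3) * v - v\<^sup>2/4"
          by (simp add: v_def power2_eq_square)
        moreover have "0 \<le> (b - (1/3 + v/2))\<^sup>2" by simp
        ultimately show ?thesis unfolding v_def by linarith
      qed
      finally show ?thesis using False by (simp add: \<mu>_def min_def algebra_simps)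
    qed
    have lin: "D * (4/9 * \<sigma> + \<theta>/9 + 4/9 * x + 1/9 * t j) - (\<sigma> + x)/9
        \<le> D * (2/3) - 1/9"
    proof -
      have "D * (4/9 * \<sigma> + \<theta>/9 + 4/9 * x + 1/9 * t j) - (\<sigma> + x)/9
          = D * ((\<theta> + t j)/9) + (4/9 * D - 1/9) * (\<sigma> + x)"
        by (simp add: field_simps)
      also have "\<dots> \<le> D * (2/9) + (4/9 * D - 1/9) * 1"
        using \<theta> \<sigma> D0 D3 by (intro add_mono mult_left_mono) auto
      finally show ?thesis by simp
    qed
    have "x * (x - 1/3)\<^sup>2 = x^3 - 2/3 * x\<^sup>2 + x/9"
      by (simp add: power2_eq_square power3_eq_cube algebra_simps)
    moreover have "(b - 1/3)\<^sup>2 = b\<^sup>2 - 2/3 * x\<^sup>2 - 2/3 * m + 1/9"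
      by (simp add: b_def power2_eq_square algebra_simps)
    moreover have "D * (4/9 * \<sigma> + \<theta>/9 - h) + D * (4/9 * x + 1/9 * t j - x * t j)
        = D * (4/9 * \<sigma> + \<theta>/9 + 4/9 * x + 1/9 * t j) - D * (x * t j + h - 2/3) - D * (2/3)"
      by (simp add: algebra_simps)
    ultimately have "x^3 + c - b\<^sup>2 + D * (x * t j + h - 2/3) < 0"
      using r mx key lin by argo
    then show ?thesis unfolding goal b_def .
  next
    case False
    define \<tau> where "\<tau> = 1 - x"
    \<comment> \<open>The tangent point belongs to the configuration with weights \<open>x\<close>,
      \<open>\<kappa>\<close>, \<open>\<kappa>\<close> and \<open>t = 1 - s\<close> throughout: its
      weights sum to 1 and its \<open>t\<close> values to 2.\<close>
    define \<kappa> where "\<kappa> = \<tau> / 2"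
    have \<tau>: "0 < \<tau>" "\<tau> \<le> 183/500" using False x1 by (auto simp: \<tau>_def)
    have \<kappa>x: "2 * \<kappa> = 1 - x" by (simp add: \<kappa>_def \<tau>_def)
    have \<kappa>D: "\<kappa>\<^sup>2 \<le> D * (1 - \<kappa>)\<^sup>2"
    proof -
      have "\<kappa>\<^sup>2 \<le> (2 * \<kappa>) * (1/2)" using \<tau> by (simp add: \<kappa>_def power2_eq_square)
      also have "\<dots> \<le> D * (1 - \<kappa>)\<^sup>2"
      proof (intro mult_mono)
        show "2 * \<kappa> \<le> D" using Dx by (simp add: \<kappa>_def \<tau>_def)
        have "(1/2::real) \<le> (4/5)\<^sup>2" by (simp add: power2_eq_square)
        also have "\<dots> \<le> (1 - \<kappa>)\<^sup>2" using \<tau> by (intro power_mono) (auto simp: \<kappa>_def)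
        finally show "1/2 \<le> (1 - \<kappa>)\<^sup>2" .
      qed (use D0 in auto)
      finally show ?thesis .
    qed
    have r: "c - 2 * \<kappa> * m + \<kappa>\<^sup>2 * \<sigma> \<le> D * ((1 - \<kappa>)\<^sup>2 * \<sigma> + \<kappa>\<^sup>2 * \<theta> - h)"
    proof (rule rest)
      fix i assume i: "i \<in> R"
      have "\<bar>s i - \<kappa>\<bar> \<le> \<kappa>" using sR[OF i] s0[OF RI(1)[OF i]] \<kappa>x by linarith
      then have "(s i - \<kappa>)\<^sup>2 \<le> \<kappa>\<^sup>2" by (metis abs_ge_zero power2_abs power_mono)
      then show "(s i - \<kappa>)\<^sup>2 \<le> D * (1 - \<kappa>)\<^sup>2" using \<kappa>D by linarith
    qed
    have b1: "(D * (1 - \<kappa>)\<^sup>2 - \<kappa>\<^sup>2) * \<sigma> \<le> (D * (1 - \<kappa>)\<^sup>2 - \<kappa>\<^sup>2) * \<tau>"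
      using \<kappa>D \<sigma> by (intro mult_left_mono) (auto simp: \<tau>_def)
    have b2: "D * (\<kappa>\<^sup>2 * \<theta>) \<le> D * (\<kappa>\<^sup>2 * (2 - t j))"
      using D0 \<theta> by (intro mult_left_mono) auto
    have "\<kappa>\<^sup>2 < x"
    proof -
      have "\<kappa> * \<kappa> \<le> \<kappa> * 1" using \<tau> by (intro mult_left_mono) (auto simp: \<kappa>_def)
      moreover have "\<kappa> < x" using \<kappa>x False by linarith
      ultimately show ?thesis by (simp add: power2_eq_square)
    qed
    then have b3: "D * ((x - \<kappa>\<^sup>2) * t j) < D * ((x - \<kappa>\<^sup>2) * \<tau>)"
      using D0 x1 by (simp add: \<tau>_def)
    \<comment> \<open>\<open>E\<close> arises by replacing \<open>\<sigma>\<close>,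
      \<open>\<theta>\<close> and \<open>t j\<close> by their upper bounds. It depends only on
      \<open>\<tau>\<close> and \<open>m\<close>, and the identity below writes it as minus three
      terms that are nonnegative for \<open>\<tau> \<le> 183/500\<close>.\<close>
    define E where "E = x^3 + 2*\<kappa>*m - \<kappa>\<^sup>2*\<tau> - (x\<^sup>2+m)\<^sup>2
      + D * ((1 - \<kappa>)\<^sup>2 * \<tau> + 2 * \<kappa>\<^sup>2 + (x - \<kappa>\<^sup>2) * \<tau> - 2/3)"
    have "x^3 + c - (x\<^sup>2 + m)\<^sup>2 + D * (x * t j + h - 2/3) < E"
      using r b1 b2 b3 unfolding E_def by (simp add: algebra_simps)
    also have "E = - \<tau> * ((1/2 - \<tau>) * (\<tau>\<^sup>2/2 - 2*\<tau> + 2/3)) - m * (4/3 + \<tau>\<^sup>2/2 - 3*\<tau>) - m\<^sup>2"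
      unfolding E_def D_def \<kappa>_def \<tau>_def by (simp add: field_simps power2_eq_square power3_eq_cube)
    also have "\<dots> \<le> 0"
    proof -
      \<comment> \<open>The quadratic in \<open>\<tau>\<close> is compared with its value at
        \<open>183/500\<close>, which is barely positive; this limits the threshold on
        \<open>x\<close> from below.\<close>
      have "0 \<le> (183/500 - \<tau>) * (2 - 183/1000 - \<tau>/2)"
        using \<tau> by (intro mult_nonneg_nonneg) auto
      moreover have "\<tau>\<^sup>2/2 - 2*\<tau> + 2/3
          = (183/500 - \<tau>) * (2 - 183/1000 - \<tau>/2) + (2/3 - 183/500 * (2 - 183/1000))"
        by (simp add: power2_eq_square field_simps)
      ultimately have "0 \<le> \<tau>\<^sup>2/2 - 2*\<tau> + 2/3" by simp
      then have "0 \<le> \<tau> * ((1/2 - \<tau>) * (\<tau>\<^sup>2/2 - 2*\<tau> + 2/3))"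
        using \<tau> by (intro mult_nonneg_nonneg) auto
      moreover have "0 \<le> m * (4/3 + \<tau>\<^sup>2/2 - 3*\<tau>)"
      proof (rule mult_nonneg_nonneg)
        have "0 \<le> \<tau>\<^sup>2" by simp
        then show "0 \<le> 4/3 + \<tau>\<^sup>2/2 - 3*\<tau>" using \<tau> by linarith
      qed (rule m0)
      moreover have "0 \<le> m\<^sup>2" by simp
      ultimately show ?thesis by linarith
    qed
    finally show ?thesis unfolding goal .
  qed
qed

section \<open>Curvature conditions on a plane against frame bounds\<close>

text \<open>The subspace \<open>W\<close> is projected onto the complement of \<open>u\<close>. For
  an orthonormal pair in the image, \<open>crit\<close> determines the lift back to
  \<open>W\<close>, and \<open>curv\<close> becomes a condition on \<open>T\<close>,
  \<open>d\<close> and \<open>B\<close>. Its sum over the pair contradicts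
  \<open>frame_weight_inequality\<close> for the weights \<open>(b i)\<^sup>2\<close>.\<close>

lemma no_positive_curvature_plane:
  fixes u :: "'a::euclidean_space" and a :: "'i \<Rightarrow> 'a"
  assumes fin: "finite I" and u1: "u \<bullet> u = 1"
    and W: "subspace W" "2 \<le> dim W"
    and frame: "\<And>x. (\<Sum>i\<in>I. (a i \<bullet> x)\<^sup>2) \<le> x \<bullet> x"
    and short: "\<And>i. i \<in> I \<Longrightarrow> a i \<bullet> a i \<le> r" and r: "0 \<le> r" "r < 1"
    and crit: "\<And>x. x \<in> W \<Longrightarrow> u \<bullet> x = (\<Sum>i\<in>I. (a i \<bullet> u)^3 * (a i \<bullet> x))"
    and curv: "\<And>x. x \<in> W \<Longrightarrow>
      x \<bullet> x + 2 * (u \<bullet> x)\<^sup>2 \<le> 3 * (\<Sum>i\<in>I. (a i \<bullet> u)\<^sup>2 * (a i \<bullet> x)\<^sup>2)"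
  shows False
proof -
  define b where "b i = a i \<bullet> u" for i
  define T where "T e = (\<Sum>i\<in>I. (b i)\<^sup>2 * (a i \<bullet> e)\<^sup>2)" for e
  define d where "d e = (\<Sum>i\<in>I. (b i)^3 * (a i \<bullet> e))" for e
  define B where "B = (\<Sum>i\<in>I. ((b i)\<^sup>2)\<^sup>2)"
  define C where "C = (\<Sum>i\<in>I. ((b i)\<^sup>2)^3)"
  have bb: "(b i)\<^sup>2 \<le> r" if "i \<in> I" for i
    using Cauchy_Schwarz_ineq[of "a i" u] short[OF that] u1 by (simp add: b_def)
  have sumb: "(\<Sum>i\<in>I. (b i)\<^sup>2) \<le> 1" using frame[of u] u1 by (simp add: b_def)
  have "B \<le> (\<Sum>i\<in>I. r * (b i)\<^sup>2)"
    unfolding B_def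
  proof (rule sum_mono)
    fix i assume "i \<in> I"
    then show "((b i)\<^sup>2)\<^sup>2 \<le> r * (b i)\<^sup>2"
      unfolding power2_eq_square[of "(b i)\<^sup>2"] by (intro mult_right_mono bb) auto
  qed
  also have "\<dots> \<le> r * 1"
    unfolding sum_distrib_left[symmetric] using sumb r by (intro mult_left_mono)
  finally have B1: "B < 1" using r by simp
  have du: "d u = B"
    unfolding d_def B_def b_def by (intro sum.cong) (auto simp: power2_eq_square power3_eq_cube)
  have d_lin: "d (x + c *\<^sub>R y) = d x + c * d y" for x y c
    by (simp add: d_def inner_add_right algebra_simps sum.distrib sum_distrib_left)
  define \<pi> where "\<pi> x = x - (u \<bullet> x) *\<^sub>R u" for x
  have lin: "linear \<pi>"
    unfolding \<pi>_def by (intro linearI) (auto simp: inner_add_right algebra_simps)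
  \<comment> \<open>For a vector of \<open>W\<close> on the line of \<open>u\<close>,
    \<open>crit\<close> says that its \<open>u\<close>-component equals itself times
    \<open>B\<close>, and \<open>B < 1\<close>.\<close>
  have inj: "inj_on \<pi> W"
  proof (subst linear_inj_on_iff_eq_0[OF lin W(1)], intro ballI impI)
    fix x assume x: "x \<in> W" "\<pi> x = 0"
    then have xu: "x = 0 + (u \<bullet> x) *\<^sub>R u" by (simp add: \<pi>_def)
    have "u \<bullet> x = d x" using crit[OF x(1)] by (simp add: d_def b_def)
    also have "\<dots> = d 0 + (u \<bullet> x) * d u" by (subst xu) (rule d_lin)
    finally have "u \<bullet> x = (u \<bullet> x) * B" by (simp add: du) (simp add: d_def)
    then have "u \<bullet> x = 0" using B1 by auto
    then show "x = 0" using xu by simp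
  qed
  have "dim (\<pi> ` W) = dim W"
    using lin inj W(1) by (intro dim_image_eq) (auto simp: span_eq_iff[THEN iffD2])
  then have "2 \<le> dim (\<pi> ` W)" using W by simp
  moreover obtain E where E: "E \<subseteq> \<pi> ` W" "pairwise orthogonal E" "\<And>x. x \<in> E \<Longrightarrow> norm x = 1"
      "card E = dim (\<pi> ` W)"
    using orthonormal_basis_subspace[OF linear_subspace_image[OF lin W(1)]] by metis
  ultimately have "2 \<le> card E" by simp
  then obtain F where F: "F \<subseteq> E" "card F = 2" by (rule obtain_subset_with_card_n)
  then obtain e1 e2 where e: "e1 \<in> E" "e2 \<in> E" "e1 \<noteq> e2" by (auto simp: card_2_iff)
  have on: "e1 \<bullet> e1 = 1" "e2 \<bullet> e2 = 1" "e1 \<bullet> e2 = 0" "e2 \<bullet> e1 = 0"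
    using E(2,3) e by (auto simp: pairwise_def orthogonal_def dot_square_norm)
  have eW: "u \<bullet> v = 0 \<and> (\<exists>c. v + c *\<^sub>R u \<in> W)" if "v \<in> E" for v
  proof -
    obtain x where x: "x \<in> W" "v = \<pi> x" using E(1) \<open>v \<in> E\<close> by blast
    then have "v + (u \<bullet> x) *\<^sub>R u = x" "u \<bullet> v = 0"
      using u1 by (auto simp: \<pi>_def inner_diff_right)
    then show ?thesis using x(1) by metis
  qed
  then have ue: "u \<bullet> e1 = 0" "u \<bullet> e2 = 0" "e1 \<bullet> u = 0" "e2 \<bullet> u = 0"
    using e by (auto simp: inner_commute)
  \<comment> \<open>The lift of \<open>v\<close> is \<open>v + c *\<^sub>R u\<close> with
    \<open>c * (1 - B) = d v\<close>. Its curvature inequality is multiplied by \<open>1 - B\<close>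
    so that \<open>c\<close> can be eliminated.\<close>
  have curv': "0 \<le> (1 - B) * (3 * T v - 1) + 3 * (d v)\<^sup>2" if v: "v \<in> E" for v
  proof -
    obtain c where x: "v + c *\<^sub>R u \<in> W" using eW[OF v] by blast
    have vu: "u \<bullet> v = 0" "v \<bullet> u = 0" "v \<bullet> v = 1"
      using eW[OF v] E(3)[OF v] by (auto simp: inner_commute dot_square_norm)
    have c: "c * (1 - B) = d v"
      using crit[OF x] d_lin[of v c u] u1 vu
      by (simp add: du inner_add_right algebra_simps) (simp add: d_def b_def inner_add_right algebra_simps)
    have "(\<Sum>i\<in>I. (b i)\<^sup>2 * (a i \<bullet> (v + c *\<^sub>R u))\<^sup>2) = T v + 2 * c * d v + c\<^sup>2 * B"
      unfolding T_def d_def B_def sum_distrib_left sum.distrib[symmetric]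
      by (intro sum.cong)
        (auto simp: inner_add_right b_def power2_eq_square power3_eq_cube algebra_simps)
    then have "1 + 3 * c\<^sup>2 \<le> 3 * (T v + 2 * c * d v + c\<^sup>2 * B)"
      using curv[OF x] vu u1 by (simp add: b_def inner_add_left inner_add_right power2_eq_square)
    then have "0 \<le> (1 - B) * (3 * (T v + 2 * c * d v + c\<^sup>2 * B) - (1 + 3 * c\<^sup>2))"
      using B1 by simp
    also have "\<dots> = (1 - B) * (3 * T v - 1) + 6 * (c * (1 - B)) * d v - 3 * (c * (1 - B))\<^sup>2"
      by (simp add: power2_eq_square algebra_simps)
    also have "\<dots> = (1 - B) * (3 * T v - 1) + 3 * (d v)\<^sup>2"
      unfolding c by (simp add: power2_eq_square)
    finally show ?thesis .
  qed
  \<comment> \<open>testing against the projection onto the span of \<open>u\<close>, \<open>e1\<close>, \<open>e2\<close> gives the Bessel inequalities\<close>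
  define f where "f x y z = x *\<^sub>R u + y *\<^sub>R e1 + z *\<^sub>R e2" for x y z :: real
  have ff: "f x y z \<bullet> f x y z = x\<^sup>2 + y\<^sup>2 + z\<^sup>2" for x y z
    by (simp add: f_def inner_add_left inner_add_right on ue u1 power2_eq_square)
  \<comment> \<open>Cauchy-Schwarz against a projection has this form, with \<open>q\<close> the
    squared length of the projection; \<open>q\<close> may vanish.\<close>
  have quot: "q \<le> K" if "q\<^sup>2 \<le> K * q" "0 \<le> K" for q K :: real
    using that by (cases "q \<le> 0") (auto simp: power2_eq_square)
  have dd: "(d e1)\<^sup>2 + (d e2)\<^sup>2 \<le> C - B\<^sup>2"
  proof -
    \<comment> \<open>This is the projection of the vector sum of
      \<open>(b i)^3 *\<^sub>R a i\<close>, whose coordinates are \<open>d u = B\<close>,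
      \<open>d e1\<close> and \<open>d e2\<close>.\<close>
    let ?g = "f B (d e1) (d e2)"
    have "(?g \<bullet> ?g)\<^sup>2 = (\<Sum>i\<in>I. (b i)^3 * (a i \<bullet> ?g))\<^sup>2"
    proof -
      have "(\<Sum>i\<in>I. (b i)^3 * (a i \<bullet> ?g)) = d (B *\<^sub>R u + d e1 *\<^sub>R e1 + d e2 *\<^sub>R e2)"
        by (simp add: d_def f_def)
      also have "\<dots> = d (0 + B *\<^sub>R u) + d e1 * d e1 + d e2 * d e2"
        by (simp only: d_lin add_0_left)
      also have "d (0 + B *\<^sub>R u) = d 0 + B * d u" by (rule d_lin)
      also have "d 0 = 0" by (simp add: d_def)
      finally show ?thesis by (simp add: ff du power2_eq_square)
    qed
    also have "\<dots> \<le> (\<Sum>i\<in>I. ((b i)^3)\<^sup>2) * (\<Sum>i\<in>I. (a i \<bullet> ?g)\<^sup>2)"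
      by (rule Cauchy_Schwarz_ineq_sum)
    also have "(\<Sum>i\<in>I. ((b i)^3)\<^sup>2) = C"
      unfolding C_def by (simp add: power_mult[symmetric] mult.commute)
    also have "C * (\<Sum>i\<in>I. (a i \<bullet> ?g)\<^sup>2) \<le> C * (?g \<bullet> ?g)"
      by (intro mult_left_mono frame) (auto simp: C_def intro!: sum_nonneg)
    finally have "?g \<bullet> ?g \<le> C" by (rule quot) (auto simp: C_def intro!: sum_nonneg)
    then show ?thesis by (simp add: ff)
  qed
  define t where "t i = (a i \<bullet> e1)\<^sup>2 + (a i \<bullet> e2)\<^sup>2" for i
  have "C - B\<^sup>2 + (1 - B) * ((\<Sum>i\<in>I. (b i)\<^sup>2 * t i) - 2/3) < 0"
    unfolding C_def B_def
  proof (rule frame_weight_inequality[OF fin _ _ _ sumb])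
    fix i assume i: "i \<in> I"
    let ?g = "f (b i) (a i \<bullet> e1) (a i \<bullet> e2)"
    have "a i \<bullet> ?g = (b i)\<^sup>2 + t i"
      by (simp add: f_def inner_add_right t_def b_def power2_eq_square)
    then have "((b i)\<^sup>2 + t i)\<^sup>2 \<le> (a i \<bullet> a i) * ((b i)\<^sup>2 + t i)"
      using Cauchy_Schwarz_ineq[of "a i" ?g] by (simp add: ff t_def add.assoc)
    then have "(b i)\<^sup>2 + t i \<le> a i \<bullet> a i" by (rule quot) simp
    then show "(b i)\<^sup>2 + t i < 1" using short[OF i] r by simp
  next
    show "(\<Sum>i\<in>I. t i) \<le> 2"
      using frame[of e1] frame[of e2] by (simp add: t_def sum.distrib on)
  qed (auto simp: t_def)
  moreover have "(\<Sum>i\<in>I. (b i)\<^sup>2 * t i) = T e1 + T e2"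
    by (simp add: T_def t_def distrib_left sum.distrib)
  ultimately have "C - B\<^sup>2 + (1 - B) * (T e1 + T e2 - 2/3) < 0" by simp
  moreover have "(1 - B) * (3 * T e1 - 1) + (1 - B) * (3 * T e2 - 1)
      = 3 * ((1 - B) * (T e1 + T e2 - 2/3))"
    by (simp add: field_simps)
  ultimately show False using curv'[OF e(1)] curv'[OF e(2)] dd by linarith
qed

section \<open>Matrices and subspaces\<close>

lemma transpose_add: "transpose (A + B) = transpose A + transpose B"
  by (simp add: transpose_def vec_eq_iff)

lemma transpose_diff: "transpose (A - B) = transpose A - transpose B"
  for A :: "'a::group_add^'m^'n"
  by (simp add: transpose_def vec_eq_iff)

lemma transpose_outer: "transpose (outer a b) = outer b a"
  by (simp add: transpose_def outer_def vec_eq_iff mult.commute)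

lemma matrix_mult_outer: "A ** outer a b = outer (A *v a) b"
  by (simp add: matrix_eq matrix_vector_mul_assoc[symmetric] outer_mult_vec matrix_vector_mult_scaleR)

lemma outer_matrix_mult: "outer a b ** A = outer a (b v* A)"
  by (simp add: matrix_eq matrix_vector_mul_assoc[symmetric] outer_mult_vec dot_lmul_matrix)

lemma inner_transpose: "transpose A \<bullet> transpose B = A \<bullet> B" for A :: "real^'m^'n"
  unfolding inner_vec_def transpose_def by (simp, rule sum.swap)

lemma inner_matrix_mult_left: "(A ** B) \<bullet> C = B \<bullet> (transpose A ** C)"
  for A :: "real^'m^'n"
  by (simp flip: frob_eq_inner add: frob_def matrix_transpose_mul matrix_mul_assoc)

lemma inner_matrix_mult_right: "(A ** B) \<bullet> C = A \<bullet> (C ** transpose B)"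
  for A :: "real^'m^'n"
  using inner_transpose[of "A ** B" C] inner_transpose[of A "C ** transpose B"]
  by (simp add: matrix_transpose_mul inner_matrix_mult_left)

lemma inner_outer: "outer a b \<bullet> X = a \<bullet> (X *v b)"
  by (simp add: inner_vec_def outer_def matrix_vector_mult_def sum_distrib_left mult_ac)

lemma matrix_factor_through_range:
  fixes A :: "real^'k^'n" and B :: "real^'m^'n"
  assumes "\<And>y. B *v y \<in> range ((*v) A)"
  obtains G :: "real^'m^'k" where "A ** G = B"
proof -
  have "\<forall>j. \<exists>g. A *v g = column j B"
    using assms by (metis image_iff matrix_vector_mult_basis)
  then obtain g where g: "\<And>j. A *v g j = column j B" by metis
  have "A ** (\<chi> i j. g j $ i) = B"
    using g by (simp add: vec_eq_iff matrix_matrix_mult_def matrix_vector_mult_def column_def)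
  then show ?thesis by (rule that)
qed

text \<open>A vector of \<open>U\<close> orthogonal to the range of \<open>P ** A\<close> is
  annihilated by the transpose of \<open>A\<close>, and that range is spanned by
  \<open>CARD('l)\<close> columns.\<close>

lemma dim_le_dim_kernel_plus:
  fixes A :: "real^'l^'n"
  assumes U: "subspace U"
  shows "dim U \<le> dim {x \<in> U. x v* A = 0} + CARD('l)"
proof -
  define P where "P = orth_projector U"
  have P: "is_orth_projector P U" unfolding P_def using U by (rule orth_projector)
  define R where "R = range ((*v) (P ** A))"
  have R: "subspace R" unfolding R_def by (intro linear_subspace_image) auto
  have "R \<subseteq> U"
    using P by (auto simp: R_def is_orth_projector_def matrix_vector_mul_assoc[symmetric])
  moreover have "x v* A = 0" if "x \<in> U" "\<forall>y\<in>R. orthogonal y x" for x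
  proof -
    have "P *v x = x"
      using P that(1) unfolding is_orth_projector_def by (metis imageE matrix_vector_mul_assoc)
    then have "x = x v* P"
      using P unfolding is_orth_projector_def by (metis transpose_matrix_vector)
    moreover have "orthogonal ((P ** A) *v (x v* A)) x"
      using that(2) unfolding R_def by blast
    ultimately have "(x v* A) \<bullet> (x v* A) = 0"
      by (metis (no_types) dot_lmul_matrix inner_commute matrix_vector_mul_assoc orthogonal_def)
    then show ?thesis by simp
  qed
  ultimately have "dim U \<le> dim {x \<in> U. x v* A = 0} + dim R"
    using dim_subspace_orthogonal_to_vectors[OF R U]
      dim_subset[of "{y \<in> U. \<forall>x\<in>R. orthogonal x y}" "{x \<in> U. x v* A = 0}"]
    by fastforce
  moreover have "dim R \<le> CARD('l)"
    unfolding R_def using dim_image_le[of "(*v) (P ** A)" UNIV] by simp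
  ultimately show ?thesis by simp
qed

lemma subspace_codim_one:
  fixes U :: "'a::euclidean_space set"
  assumes A: "subspace A" and U: "subspace U" and AU: "A \<subseteq> U" and d: "dim U = dim A + 1"
  obtains u where "u \<in> U" "u \<bullet> u = 1" "A = {y \<in> U. u \<bullet> y = 0}"
proof -
  have "dim {y \<in> U. \<forall>x\<in>A. orthogonal x y} = 1"
    using dim_subspace_orthogonal_to_vectors[OF A U AU] d by simp
  then have "\<not> {y \<in> U. \<forall>x\<in>A. orthogonal x y} \<subseteq> {0}" by (metis dim_eq_0 zero_neq_one)
  then obtain v where v: "v \<in> U" "\<forall>x\<in>A. orthogonal x v" "v \<noteq> 0" by blast
  define u where "u = v /\<^sub>R norm v"
  have u: "u \<in> U" "u \<bullet> u = 1" "\<forall>x\<in>A. u \<bullet> x = 0"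
    using v U by (auto simp: u_def subspace_scale orthogonal_def inner_commute dot_square_norm
        power2_eq_square field_simps)
  have H: "subspace {y \<in> U. u \<bullet> y = 0}"
    using U by (auto simp: subspace_def inner_add_right)
  have AH: "A \<subseteq> {y \<in> U. u \<bullet> y = 0}" using AU u by auto
  have "dim {y \<in> U. u \<bullet> y = 0} < dim U"
  proof (rule dim_psubset)
    have "u \<notin> {y \<in> U. u \<bullet> y = 0}" using u by simp
    then show "span {y \<in> U. u \<bullet> y = 0} \<subset> span U"
      unfolding span_eq_iff[THEN iffD2, OF H] span_eq_iff[THEN iffD2, OF U] using u(1) by blast
  qed
  then have "A = {y \<in> U. u \<bullet> y = 0}"
    using d by (intro subspace_dim_equal[OF A H AH]) simp
  with u show ?thesis by (intro that)
qed

section \<open>Orthogonal projectors and the space \<open>Sym_on U\<close>\<close>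

lemma orth_projector_simps:
  assumes "subspace U"
  shows "transpose (orth_projector U) = orth_projector U"
    and "orth_projector U ** orth_projector U = orth_projector U"
    and "orth_projector U *v x \<in> U"
    and "x \<in> U \<Longrightarrow> orth_projector U *v x = x"
    and "x v* orth_projector U = orth_projector U *v x"
proof -
  note P = orth_projector[OF assms, unfolded is_orth_projector_def]
  show "transpose (orth_projector U) = orth_projector U"
    "orth_projector U ** orth_projector U = orth_projector U"
    using P by auto
  show "orth_projector U *v x \<in> U" using P by blast
  show "orth_projector U *v x = x" if "x \<in> U"
    using P that by (metis imageE matrix_vector_mul_assoc)
  show "x v* orth_projector U = orth_projector U *v x"
    using P by (metis transpose_matrix_vector)
qed

lemma matrix_add_rdistrib: "(A + B) ** C = A ** C + B ** C"
  by (simp add: matrix_eq matrix_vector_mul_assoc[symmetric] matrix_vector_mult_add_rdistrib)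

lemma linear_sandwich: "linear (\<lambda>X::real^'n^'n. A ** X ** B)" for A :: "real^'n^'n"
  by (intro linearI) (auto simp: matrix_add_ldistrib matrix_add_rdistrib scalar_matrix_assoc matrix_scalar_ac)

lemma linear_transpose: "linear (transpose :: real^'n^'n \<Rightarrow> real^'n^'n)"
  by (intro linearI) (auto simp: transpose_add transpose_scalar)

lemma subspace_Sym_on: "subspace (Sym_on U)"
proof -
  let ?P = "orth_projector U"
  note [simp] = linear_add[OF linear_sandwich] linear_scale[OF linear_sandwich] 
    linear_add[OF linear_transpose] linear_scale[OF linear_transpose]
    linear_0[OF linear_sandwich] linear_0[OF linear_transpose]
  show ?thesis unfolding subspace_def Sym_on_def symmetric_mat_def by simp
qed

section \<open>Operators on symmetric matrices\<close>

lemma Sym_onD: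
  assumes "subspace U" "X \<in> Sym_on U"
  shows "transpose X = X" "orth_projector U ** X = X" "X ** orth_projector U = X"
proof -
  let ?P = "orth_projector U"
  have X: "?P ** X ** ?P = X" and "transpose X = X"
    using assms(2) by (auto simp: Sym_on_def symmetric_mat_def)
  then show "transpose X = X" by simp
  show "?P ** X = X" "X ** ?P = X"
    using X orth_projector_simps(2)[OF assms(1)] by (metis matrix_mul_assoc)+
qed

lemma sandwich_in_Sym_on:
  assumes "subspace U" "transpose X = X"
  shows "orth_projector U ** X ** orth_projector U \<in> Sym_on U"
proof -
  let ?P = "orth_projector U"
  note P = orth_projector_simps(1,2)[OF assms(1)]
  have "?P ** (?P ** X ** ?P) ** ?P = ?P ** X ** ?P" by (metis P(2) matrix_mul_assoc)
  moreover have "transpose (?P ** X ** ?P) = ?P ** X ** ?P"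
    by (simp add: matrix_transpose_mul P(1) assms(2) matrix_mul_assoc)
  ultimately show ?thesis by (simp add: Sym_on_def symmetric_mat_def)
qed

lemma inner_sandwich:
  assumes "subspace U" "S \<in> Sym_on U"
  shows "(orth_projector U ** X ** orth_projector U) \<bullet> S = X \<bullet> S"
  using Sym_onD[OF assms] orth_projector_simps(1)[OF assms(1)]
    inner_matrix_mult_right[of "orth_projector U ** X" "orth_projector U" S]
    inner_matrix_mult_left[of "orth_projector U" X S]
  by simp

text \<open>Positive definiteness makes \<open>L\<close> injective, and finite dimension then makes
  it surjective. This turns the \<open>inv_into\<close> of the structured inverse into a genuine
  inverse.\<close>

lemma Sym_on_bij_betw:
  assumes U: "subspace U" and lin: "linear_op_on U L" and pd: "pos_def_on U L"
  shows "bij_betw L (Sym_on U) (Sym_on U)"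
proof -
  let ?P = "orth_projector U" and ?Y = "Sym_on U"
  note sub = subspace_Sym_on[of U]
  have maps: "L X \<in> ?Y" if "X \<in> ?Y" for X
    using lin that by (auto simp: linear_op_on_def)
  have add: "L (X + Y) = L X + L Y" if "X \<in> ?Y" "Y \<in> ?Y" for X Y
    using lin that by (auto simp: linear_op_on_def)
  have scale: "L (c *\<^sub>R X) = c *\<^sub>R L X" if "X \<in> ?Y" for X c
    using lin that by (auto simp: linear_op_on_def)
  \<comment> \<open>\<open>L\<close> is known to be linear only on \<open>Sym_on U\<close>.
    Composing it with the linear projection \<open>\<pi>\<close> onto that space gives a total
    linear map, to which the dimension theorems apply.\<close>
  define \<pi> where "\<pi> X = ?P ** ((1/2) *\<^sub>R (X + transpose X)) ** ?P" for X
  have lin\<pi>: "linear \<pi>"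
    unfolding \<pi>_def
    using linear_compose[OF linear_compose_scale_right[OF linear_compose_add[OF linear_id linear_transpose], of "1/2"]
        linear_sandwich[of ?P ?P]]
    by (simp add: o_def)
  have \<pi>Y: "\<pi> X \<in> ?Y" for X
    unfolding \<pi>_def using U
    by (intro sandwich_in_Sym_on) (simp_all add: transpose_scalar transpose_add add.commute)
  have \<pi>id: "\<pi> X = X" if "X \<in> ?Y" for X
    using Sym_onD[OF U that] by (simp add: \<pi>_def scaleR_2[symmetric])
  define K where "K = L \<circ> \<pi>"
  have linK: "linear K"
    unfolding K_def using linear_add[OF lin\<pi>] linear_scale[OF lin\<pi>] add scale \<pi>Y
    by (intro linearI) auto
  have KL: "K X = L X" if "X \<in> ?Y" for X using \<pi>id[OF that] by (simp add: K_def)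
  have inj: "inj_on K ?Y"
  proof (subst linear_inj_on_iff_eq_0[OF linK sub], intro ballI impI)
    fix X assume "X \<in> ?Y" "K X = 0"
    then show "X = 0" using pd KL by (auto simp: pos_def_on_def frob_eq_inner)
  qed
  have "dim (K ` ?Y) = dim ?Y"
    using linK inj sub by (intro dim_image_eq) (auto simp: span_eq_iff[THEN iffD2])
  then have "K ` ?Y = ?Y"
    using maps KL sub linK by (intro subspace_dim_equal linear_subspace_image) auto
  with inj have "bij_betw K ?Y ?Y" by (simp add: bij_betw_def)
  then show ?thesis using KL by (simp cong: bij_betw_cong)
qed

text \<open>The objective is a convex quadratic in the Gram matrix. Its increment along
  \<open>E\<close> is \<open>- 2 * (E \<bullet> S) + E \<bullet> L E\<close>, where the first term
  is nonnegative because \<open>S\<close> is negative semidefinite and orthogonal to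
  \<open>Z ** transpose Z\<close>, and the second because \<open>L\<close> is positive
  definite.\<close>

lemma optimal_if_slack_nonpos:
  fixes Zs :: "real^'l^'n" and Z W :: "real^'k^'n"
  assumes U: "subspace U" and lin: "linear_op_on U L" and sa: "self_adjoint_on U L"
    and pd: "pos_def_on U L"
    and crit: "first_order_critical U L Zs Z"
    and neg: "\<And>x. x \<bullet> (slack U L Zs Z *v x) \<le> 0"
  shows "objective U L Zs Z \<le> objective U L Zs W"
proof -
  let ?P = "orth_projector U"
  define S where "S = slack U L Zs Z"
  define pr where "pr X = ?P ** X ** ?P" for X
  define Dz where "Dz = pr (Z ** transpose Z - Zs ** transpose Zs)"
  define E where "E = pr (W ** transpose W - Z ** transpose Z)"
  have prY: "pr (A ** transpose A - B ** transpose B) \<in> Sym_on U"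
    for A :: "real^'a^'n" and B :: "real^'b^'n"
    unfolding pr_def by (intro sandwich_in_Sym_on U) (simp add: transpose_diff matrix_transpose_mul)
  have pr_lin: "linear pr" unfolding pr_def by (rule linear_sandwich)
  have DzY: "Dz \<in> Sym_on U" and EY: "E \<in> Sym_on U" unfolding Dz_def E_def by (rule prY)+
  have L_add: "L (X + Y) = L X + L Y" if "X \<in> Sym_on U" "Y \<in> Sym_on U" for X Y
    using lin that by (auto simp: linear_op_on_def)
  have L_scale: "L (c *\<^sub>R X) = c *\<^sub>R L X" and LY: "L X \<in> Sym_on U"
    if "X \<in> Sym_on U" for X c
    using lin that by (auto simp: linear_op_on_def)
  have obj: "objective U L Zs A = Da \<bullet> L Da"
    if Da: "Da = pr (A ** transpose A - Zs ** transpose Zs)" for A :: "real^'k^'n" and Da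
  proof -
    have "Da \<in> Sym_on U" unfolding Da by (rule prY)
    then have "L Da \<in> Sym_on U" using LY by blast
    then show ?thesis
      unfolding objective_def Let_def ext_op_def frob_eq_inner pr_def[symmetric] Da[symmetric]
      by (metis Da inner_sandwich[OF U] pr_def)
  qed
  have S: "S = - L Dz"
  proof -
    have "pr (Zs ** transpose Zs - Z ** transpose Z) = (-1) *\<^sub>R Dz"
      unfolding Dz_def linear_scale[OF pr_lin, symmetric] by simp
    then have "S = L ((-1) *\<^sub>R Dz)" unfolding S_def slack_def ext_op_def pr_def[symmetric] by simp
    then show ?thesis using L_scale[OF DzY, of "-1"] by simp
  qed
  have SY: "S \<in> Sym_on U"
    unfolding S using LY[OF DzY] subspace_Sym_on subspace_neg by blast
  have psd: "(A ** transpose A) \<bullet> S \<le> 0" for A :: "real^'k^'n"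
  proof -
    have "(A ** transpose A) \<bullet> S = transpose A \<bullet> (transpose A ** S)"
      by (simp add: inner_matrix_mult_left)
    also have "\<dots> = A \<bullet> (S ** A)"
      using inner_transpose[of A "S ** A"] Sym_onD(1)[OF U SY] by (simp add: matrix_transpose_mul)
    also have "\<dots> = (\<Sum>j\<in>UNIV. column j A \<bullet> (S *v column j A))"
      unfolding inner_vec_def matrix_matrix_mult_def matrix_vector_mult_def column_def
      by (simp, rule sum.swap)
    also have "\<dots> \<le> 0" using neg by (intro sum_nonpos) (simp add: S_def)
    finally show ?thesis .
  qed
  have "(Z ** transpose Z) \<bullet> S = transpose Z \<bullet> transpose (S ** Z)"
    using Sym_onD(1)[OF U SY] by (simp add: inner_matrix_mult_left matrix_transpose_mul)
  also have "\<dots> = 0"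
    using crit unfolding first_order_critical_def S_def[symmetric] by (simp add: inner_transpose)
  finally have Z0: "(Z ** transpose Z) \<bullet> S = 0" .
  have "E \<bullet> S = (W ** transpose W - Z ** transpose Z) \<bullet> S"
    unfolding E_def pr_def by (rule inner_sandwich[OF U SY])
  also have "\<dots> \<le> 0" using psd[of W] Z0 by (simp add: inner_diff_left)
  finally have ES: "E \<bullet> S \<le> 0" .
  have EE: "0 \<le> E \<bullet> L E"
    using pd EY by (cases "E = 0") (auto simp: pos_def_on_def frob_eq_inner less_imp_le)
  have "Dz + E = pr (W ** transpose W - Zs ** transpose Zs)"
    unfolding Dz_def E_def linear_add[OF pr_lin, symmetric] by simp
  then have "objective U L Zs W = (Dz + E) \<bullet> L (Dz + E)" by (rule obj)
  also have "\<dots> = Dz \<bullet> L Dz + 2 * (E \<bullet> L Dz) + E \<bullet> L E"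
    using sa DzY EY by (simp add: L_add[OF DzY EY] inner_add_left inner_add_right
        self_adjoint_on_def frob_eq_inner inner_commute)
  also have "\<dots> \<ge> Dz \<bullet> L Dz" using ES EE by (simp add: S)
  finally show ?thesis using obj[OF Dz_def] by simp
qed

lemma Gamma_op_mult_vec:
  fixes y :: "real^'n"
  shows "Gamma_op N a X *v y = (\<Sum>i=1..N. ((a i \<bullet> (X *v a i)) * (a i \<bullet> y)) *\<^sub>R a i)"
proof -
  have "(\<Sum>i\<in>I. f i) *v y = (\<Sum>i\<in>I. f i *v y)" if "finite I" for f :: "nat \<Rightarrow> real^'n^'n" and I
    using that by (induction I rule: finite_induct) (auto simp: matrix_vector_mult_add_rdistrib)
  then show ?thesis
    by (simp add: Gamma_op_def scaleR_matrix_vector_assoc[symmetric] outer_mult_vec)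
qed

text \<open>Along \<open>V = outer x w\<close> the first-order change of the Gram matrix vanishes
  after projection to \<open>U\<close>. Only minus \<open>w \<bullet> w\<close> times the positive
  value of the slack at \<open>x\<close> remains of the curvature, which is negative unless
  \<open>w = 0\<close>.\<close>

lemma injective_if_slack_has_positive_direction:
  fixes Zs :: "real^'l^'n" and Z :: "real^'k^'n"
  assumes U: "subspace U" and lin: "linear_op_on U L"
    and crit: "second_order_critical U L Zs Z"
    and pos: "0 < x \<bullet> (slack U L Zs Z *v x)"
    and w: "orth_projector U ** Z *v w = 0"
  shows "w = 0"
proof -
  let ?P = "orth_projector U"
  note P = orth_projector_simps[OF U]
  define V where "V = outer x w"
  have VV: "V ** transpose V = (w \<bullet> w) *\<^sub>R outer x x"
    by (simp add: V_def transpose_outer matrix_mult_outer outer_mult_vec)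
      (simp add: outer_def vec_eq_iff)
  have "Z ** transpose V + V ** transpose Z = outer (Z *v w) x + outer x (Z *v w)"
    by (simp add: V_def transpose_outer matrix_mult_outer outer_matrix_mult)
  then have "?P ** (Z ** transpose V + V ** transpose Z) ** ?P = 0"
    using w by (simp add: matrix_add_ldistrib matrix_add_rdistrib matrix_mult_outer
        outer_matrix_mult P(5) matrix_vector_mul_assoc) (simp add: outer_def vec_eq_iff)
  moreover have "L 0 = 0"
  proof -
    have "L (0 *\<^sub>R 0) = 0 *\<^sub>R L 0"
      using lin subspace_0[OF subspace_Sym_on[of U]] unfolding linear_op_on_def by blast
    then show ?thesis by simp
  qed
  ultimately have "0 \<le> - ((w \<bullet> w) * (x \<bullet> (slack U L Zs Z *v x)))"
    using crit unfolding second_order_critical_def Let_def ext_op_def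
    by (auto simp: frob_eq_inner VV inner_outer dest!: spec[of _ V])
  then show ?thesis
    using pos by (metis inner_gt_zero_iff mult_pos_pos neg_0_le_iff_le not_le)
qed

section \<open>Second-order critical points\<close>

text \<open>\<open>M\<close> splits into a block on the range of \<open>P ** Z\<close> and a cross
  term with \<open>u\<close>, and both lift through a right inverse of \<open>P ** Z\<close>. The
  second equation is what later ties the direction \<open>V\<close> to the curvature.\<close>

lemma tangent_solution:
  fixes Z :: "real^'k^'n" and M :: "real^'n^'n"
  assumes U: "subspace U" and u: "u \<in> U" "u \<bullet> u = 1"
    and range: "range ((*v) (orth_projector U ** Z)) = {y \<in> U. u \<bullet> y = 0}"
    and M: "M \<in> Sym_on U" "u \<bullet> (M *v u) = 0"
  obtains V :: "real^'k^'n" where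
    "orth_projector U ** (Z ** transpose V + V ** transpose Z) ** orth_projector U = M"
    "orth_projector U ** Z *v (u v* V) = M *v u"
proof -
  define P where "P = orth_projector U"
  note P = orth_projector_simps[OF U, folded P_def]
  note MP = Sym_onD[OF U M(1), folded P_def]
  \<comment> \<open>\<open>Q\<close> is the orthogonal projector onto the range of
    \<open>P ** Z\<close>, so the \<open>G\<close> found below is a right inverse on that
    range.\<close>
  define Q where "Q = P - outer u u"
  have Qv: "Q *v y = P *v y - (u \<bullet> y) *\<^sub>R u" for y
    by (simp add: Q_def matrix_vector_mult_diff_rdistrib outer_mult_vec)
  have Pinner: "x \<bullet> (P *v y) = x \<bullet> y" if "x \<in> U" for x y
    using P(4)[OF that] P(5)[of x] by (metis dot_lmul_matrix)
  have "Q *v y \<in> range ((*v) (P ** Z))" for y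
    unfolding range[folded P_def] Qv using u P(3) U Pinner[OF u(1)]
    by (simp add: inner_diff_right subspace_diff subspace_scale)
  then obtain G where G: "(P ** Z) ** G = Q" by (rule matrix_factor_through_range)
  have Qt: "transpose Q = Q" by (simp add: Q_def transpose_diff transpose_outer P(1))
  have Qu: "Q *v u = 0" using P(4)[OF u(1)] u(2) by (simp add: Qv)
  define z where "z = M *v u"
  have zU: "z \<in> U" using MP(2) P(3) unfolding z_def by (metis matrix_vector_mul_assoc)
  have Qz: "Q *v z = z" using P(4)[OF zU] M(2) by (simp add: Qv z_def)
  have PQ: "P *v (Q *v y) = Q *v y" for y
    using P(2) P(4)[OF u(1)]
    by (simp add: Qv matrix_vector_mult_diff_distrib matrix_vector_mult_scaleR matrix_vector_mul_assoc)
  define M0 where "M0 = Q ** M ** Q"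
  have M0t: "transpose M0 = M0"
    by (simp add: M0_def matrix_transpose_mul Qt MP(1) matrix_mul_assoc)
  have QP: "Q ** P = Q"
    using PQ Qt P(1) by (metis matrix_eq matrix_transpose_mul matrix_vector_mul_assoc)
  have QQ: "Q ** Q = Q"
    using Qu PQ by (simp add: matrix_eq matrix_vector_mul_assoc[symmetric] Qv[of "Q *v _"])
      (metis QP Qt Qu dot_lmul_matrix inner_zero_left scaleR_zero_left diff_zero transpose_matrix_vector)
  have decomp: "M = M0 + outer z u + outer u z"
  proof (subst matrix_eq, intro allI)
    fix y
    have zy: "u \<bullet> (M *v y) = z \<bullet> y"
      using MP(1) by (metis dot_lmul_matrix transpose_matrix_vector z_def)
    have PM: "P *v (M *v y) = M *v y" for y using MP(2) by (simp add: matrix_vector_mul_assoc)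
    have MPy: "M *v (P *v y) = M *v y" using MP(3) by (simp add: matrix_vector_mul_assoc)
    have "M0 *v y = Q *v (M *v y - (u \<bullet> y) *\<^sub>R z)"
      unfolding M0_def matrix_vector_mul_assoc[symmetric] Qv[of y]
      by (simp add: matrix_vector_mult_diff_distrib matrix_vector_mult_scaleR MPy z_def)
    also have "\<dots> = M *v y - (z \<bullet> y) *\<^sub>R u - (u \<bullet> y) *\<^sub>R z"
      by (simp add: matrix_vector_mult_diff_distrib matrix_vector_mult_scaleR Qz Qv[of "M *v y"] PM zy)
    finally show "M *v y = (M0 + outer z u + outer u z) *v y"
      by (simp add: matrix_vector_mult_add_rdistrib outer_mult_vec)
  qed
  \<comment> \<open>The symmetric block occurs both in \<open>(P ** Z) ** transpose V\<close> and in
    its transpose, hence the factor \<open>1/2\<close>; each half of the cross term occurs in only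
    one of them.\<close>
  define V where "V = (1/2) *\<^sub>R (M0 ** transpose G) + outer u (G *v z)"
  have ZV: "(P ** Z) ** transpose V = (1/2) *\<^sub>R M0 + outer z u"
  proof -
    have "(P ** Z) ** transpose V = (1/2) *\<^sub>R (((P ** Z) ** G) ** M0) + outer (((P ** Z) ** G) *v z) u"
      unfolding V_def
      by (simp add: transpose_add transpose_scalar matrix_transpose_mul M0t transpose_outer
          matrix_add_ldistrib matrix_scalar_ac matrix_mult_outer matrix_mul_assoc matrix_vector_mul_assoc)
        (simp add: scalar_matrix_assoc matrix_scalar_ac matrix_mul_assoc)
    also have "\<dots> = (1/2) *\<^sub>R M0 + outer z u"
      unfolding G Qz by (simp add: M0_def matrix_mul_assoc QQ)
    finally show ?thesis .
  qed
  have PV: "P ** V = V"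
  proof -
    have "P *v (M0 *v y) = M0 *v y" for y
      unfolding M0_def by (simp add: matrix_vector_mul_assoc[symmetric] PQ)
    then show ?thesis
      unfolding V_def using P(4)[OF u(1)]
      by (simp add: matrix_eq matrix_vector_mul_assoc[symmetric] matrix_vector_mult_add_rdistrib
          scaleR_matrix_vector_assoc[symmetric] matrix_vector_right_distrib matrix_vector_mult_scaleR
          outer_mult_vec del: transpose_matrix_vector)
  qed
  have VP: "transpose V ** P = transpose V"
    using PV P(1) by (metis matrix_transpose_mul)
  have "P ** (Z ** transpose V + V ** transpose Z) ** P
      = (P ** Z) ** (transpose V ** P) + (P ** V) ** (transpose Z ** P)"
    by (simp add: matrix_add_ldistrib matrix_add_rdistrib matrix_mul_assoc)
  also have "\<dots> = (P ** Z) ** transpose V + transpose ((P ** Z) ** transpose V)"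
    unfolding PV VP by (simp add: matrix_transpose_mul P(1))
  also have "\<dots> = M"
    unfolding ZV by (subst decomp) (simp add: transpose_add transpose_scalar transpose_outer M0t algebra_simps
        scaleR_left_distrib[symmetric])
  finally have 1: "P ** (Z ** transpose V + V ** transpose Z) ** P = M" .
  have "u v* V = transpose V *v u" by simp
  then have "P ** Z *v (u v* V) = ((P ** Z) ** transpose V) *v u"
    by (metis matrix_vector_mul_assoc)
  also have "\<dots> = M *v u"
  proof -
    have "M0 *v u = 0" unfolding M0_def by (simp add: matrix_vector_mul_assoc[symmetric] Qu)
    then show ?thesis unfolding ZV
      by (simp add: matrix_vector_mult_add_rdistrib scaleR_matrix_vector_assoc[symmetric]
          outer_mult_vec u(2) z_def)
  qed
  finally show ?thesis using that[of V] 1 unfolding P_def by blast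
qed

text \<open>The contradiction comes from \<open>no_positive_curvature_plane\<close>, applied to the
  kernel \<open>W\<close> of \<open>transpose Zs\<close> in \<open>U\<close>. There
  \<open>crit\<close> expresses that the range of \<open>P ** Z\<close> is orthogonal to
  \<open>u\<close>, and \<open>curv\<close> is drawn from the second-order condition.\<close>

lemma slack_nonpos:
  fixes U :: "(real^'n) set" and Zs :: "real^'l^'n" and Z :: "real^'k^'n"
  assumes U: "subspace U" and lin: "linear_op_on U L" and pd: "pos_def_on U L"
    and si: "structured_inverse U L"
    and codim: "dim U = CARD('k) + 1" and rank: "CARD('l) + 1 \<le> CARD('k)"
    and crit: "second_order_critical U L Zs Z"
  shows "x \<bullet> (slack U L Zs Z *v x) \<le> 0"
proof (rule ccontr)
  define P where "P = orth_projector U"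
  note P = orth_projector_simps[OF U, folded P_def]
  define S where "S = slack U L Zs Z"
  assume "\<not> ?thesis"
  then have pos: "0 < x \<bullet> (S *v x)" by (simp add: S_def)

  obtain N a \<eta> where \<eta>: "0 < \<eta>" "\<eta> \<le> 1" and aU: "\<And>i. i \<in> {1..N} \<Longrightarrow> a i \<in> U"
    and F1: "(\<Sum>i=1..N. outer (a i) (a i)) \<preceq> P"
    and F2: "\<And>i. i \<in> {1..N} \<Longrightarrow> (norm (a i))\<^sup>2 \<le> 1 - \<eta>"
    and F3: "\<And>X. X \<in> Sym_on U \<Longrightarrow> inv_into (Sym_on U) L X = X - Gamma_op N a X"
    using si unfolding structured_inverse_def P_def by (elim exE conjE) blast

  have bij: "bij_betw L (Sym_on U) (Sym_on U)" by (rule Sym_on_bij_betw[OF U lin pd])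
  have Linv: "X - Gamma_op N a X \<in> Sym_on U" "L (X - Gamma_op N a X) = X" if "X \<in> Sym_on U" for X
    using bij that F3[OF that, symmetric]
    by (auto simp: bij_betw_inv_into_right bij_betw_apply[OF bij_betw_inv_into])

  define \<Delta> where "\<Delta> = P ** (Zs ** transpose Zs - Z ** transpose Z) ** P"
  have \<Delta>: "\<Delta> \<in> Sym_on U"
    unfolding \<Delta>_def P_def by (intro sandwich_in_Sym_on U) (simp add: transpose_diff matrix_transpose_mul)
  have SL: "S = L \<Delta>" by (simp add: S_def slack_def ext_op_def \<Delta>_def P_def)
  have SY: "S \<in> Sym_on U" unfolding SL using \<Delta> bij by (auto dest: bij_betw_apply)
  note S = Sym_onD[OF U SY, folded P_def]
  have \<Delta>S: "\<Delta> = S - Gamma_op N a S"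
    using F3[OF SY] bij \<Delta> unfolding SL by (simp add: bij_betw_inv_into_left)

  have inner_S: "y \<bullet> (S *v y') = (S *v y) \<bullet> y'" for y y'
    using S(1) by (metis dot_lmul_matrix transpose_matrix_vector)
  have inner_P: "y \<bullet> (P *v y') = (P *v y) \<bullet> y'" for y y'
    using P(5) by (metis dot_lmul_matrix)
  have SZ: "S *v (P ** Z *v w) = 0" for w
    using crit S(3) unfolding second_order_critical_def first_order_critical_def S_def[symmetric]
    by (simp add: matrix_vector_mul_assoc matrix_mul_assoc)

  \<comment> \<open>The range of \<open>P ** Z\<close> and the rank of the slack\<close>
  define R where "R = range ((*v) (P ** Z))"
  have linPZ: "linear ((*v) (P ** Z))" by simp
  have R: "subspace R" unfolding R_def by (intro linear_subspace_image linPZ subspace_UNIV)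
  have RU: "R \<subseteq> U" by (auto simp: R_def matrix_vector_mul_assoc[symmetric] P)
  have "inj ((*v) (P ** Z))"
    using injective_if_slack_has_positive_direction[OF U lin crit pos[unfolded S_def], folded P_def]
    by (simp add: linear_injective_0[OF linPZ])
  then have "dim R = CARD('k)"
    unfolding R_def using dim_image_eq[OF linPZ, of UNIV] by simp
  then obtain u where u: "u \<in> U" "u \<bullet> u = 1" and Ru: "R = {y \<in> U. u \<bullet> y = 0}"
    using subspace_codim_one[OF R U RU] codim by metis
  have S_R: "S *v y = 0" if "y \<in> R" for y using that SZ by (auto simp: R_def)
  have Sy: "S *v y = (u \<bullet> y) *\<^sub>R (S *v u)" for y
  proof -
    have "u \<bullet> (P *v y) = u \<bullet> y" using inner_P P(4)[OF u(1)] by simp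
    then have "P *v y - (u \<bullet> y) *\<^sub>R u \<in> R"
      unfolding Ru using u U P(3) by (simp add: subspace_diff subspace_scale inner_diff_right)
    from S_R[OF this] show ?thesis
      by (simp add: matrix_vector_mult_diff_distrib matrix_vector_mult_scaleR
          matrix_vector_mul_assoc S(3))
  qed
  define \<mu> where "\<mu> = u \<bullet> (S *v u)"
  have "S *v u = \<mu> *\<^sub>R u"
  proof (rule vector_eq_ldot[THEN iffD1], intro allI)
    fix y
    have "y \<bullet> (S *v u) = u \<bullet> (S *v y)" by (metis inner_S inner_commute)
    also have "\<dots> = y \<bullet> (\<mu> *\<^sub>R u)" by (subst Sy) (simp add: \<mu>_def inner_commute)
    finally show "y \<bullet> (S *v u) = y \<bullet> (\<mu> *\<^sub>R u)" .
  qed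
  then have Sv: "S *v y = (\<mu> * (u \<bullet> y)) *\<^sub>R u" for y by (subst Sy) simp
  have \<mu>0: "0 < \<mu>"
  proof -
    have "x \<bullet> (S *v x) = \<mu> * (u \<bullet> x)\<^sup>2"
      unfolding Sv[of x] by (simp add: power2_eq_square inner_commute)
    then show ?thesis using pos by (simp add: zero_less_mult_iff)
  qed
  have SM: "S = \<mu> *\<^sub>R outer u u"
    by (simp add: matrix_eq Sv scaleR_matrix_vector_assoc[symmetric] outer_mult_vec)

  define T where "T y = (\<Sum>i=1..N. ((a i \<bullet> u)\<^sup>2 * (a i \<bullet> y)) *\<^sub>R a i)" for y
  have T_inner: "z \<bullet> T y = (\<Sum>i=1..N. (a i \<bullet> u)\<^sup>2 * (a i \<bullet> y) * (a i \<bullet> z))" for y z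
    by (simp add: T_def inner_sum_right inner_commute mult_ac)
  have \<Delta>v: "\<Delta> *v y = \<mu> *\<^sub>R ((u \<bullet> y) *\<^sub>R u - T y)" for y
    unfolding \<Delta>S
    by (simp add: matrix_vector_mult_diff_rdistrib Gamma_op_mult_vec Sv T_def scaleR_diff_right
        scaleR_sum_right power2_eq_square inner_commute mult_ac)

  \<comment> \<open>First-order information on the kernel of \<open>transpose Zs\<close>\<close>
  define W where "W = {y \<in> U. y v* Zs = 0}"
  have W: "subspace W"
    using U by (auto simp: W_def subspace_def vector_matrix_left_distrib scaleR_vector_matrix_assoc)
  \<comment> \<open>The dimension of \<open>U\<close> is \<open>CARD('k) + 1\<close>, hence at least
    \<open>CARD('l) + 2\<close>.\<close>
  have dimW: "2 \<le> dim W"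
    using dim_le_dim_kernel_plus[OF U, of Zs] codim rank unfolding W_def by linarith

  \<comment> \<open>The term with \<open>Zs\<close> vanishes on \<open>W\<close>, so there
    \<open>- \<Delta>\<close> acts as the product of \<open>P ** Z\<close> with its
    transpose.\<close>
  have image_W: "(P ** Z) *v (y v* (P ** Z)) = \<mu> *\<^sub>R (T y - (u \<bullet> y) *\<^sub>R u)" if "y \<in> W" for y
  proof -
    have y: "y \<in> U" "y v* Zs = 0" using that by (auto simp: W_def)
    have "\<Delta> *v y = P *v (Zs *v (y v* Zs) - Z *v (y v* Z))"
      using P(4)[OF y(1)]
      by (simp add: \<Delta>_def matrix_vector_mul_assoc[symmetric] matrix_vector_mult_diff_rdistrib)
    also have "\<dots> = - ((P ** Z) *v (y v* Z))"
      by (simp add: y(2) linear_neg[OF matrix_vector_mul_linear] matrix_vector_mul_assoc)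
    also have "y v* Z = y v* (P ** Z)"
      by (metis P(4,5) y(1) vector_matrix_mul_assoc)
    finally show ?thesis unfolding \<Delta>v
      by (metis minus_diff_eq minus_equation_iff scaleR_minus_right)
  qed
  have u_R: "u \<bullet> ((P ** Z) *v w) = 0" for w
    using Ru unfolding R_def by blast
  have crit_W: "u \<bullet> y = u \<bullet> T y" if "y \<in> W" for y
    using u_R[of "y v* (P ** Z)"] \<mu>0 unfolding image_W[OF that]
    by (simp add: inner_diff_right u(2))

  have curv_W: "y \<bullet> y + 2 * (u \<bullet> y)\<^sup>2 \<le> 3 * (y \<bullet> T y)" if yW: "y \<in> W" for y
  proof -
    have y: "y \<in> U" using yW by (simp add: W_def)
    \<comment> \<open>The direction is chosen through its image: \<open>L\<close> is to map the
      projected derivative to \<open>X\<close>, so this derivative is the \<open>M\<close> below,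
      given by the structured inverse. Its tangency \<open>uMu\<close> follows from
      \<open>crit_W\<close>.\<close>
    define X where "X = outer u y + outer y u"
    have X: "X \<in> Sym_on U"
      using u(1) y P by (simp add: X_def Sym_on_def symmetric_mat_def transpose_add transpose_outer add.commute
          matrix_add_ldistrib matrix_add_rdistrib matrix_mult_outer outer_matrix_mult P_def[symmetric])
    define M where "M = X - Gamma_op N a X"
    note M = Linv[OF X, folded M_def]
    have Mv: "M *v z = (y \<bullet> z) *\<^sub>R u + (u \<bullet> z) *\<^sub>R y
        - (\<Sum>i=1..N. (2 * (a i \<bullet> u) * (a i \<bullet> y) * (a i \<bullet> z)) *\<^sub>R a i)" for z
      by (simp add: M_def X_def matrix_vector_mult_diff_rdistrib matrix_vector_mult_add_rdistrib
          outer_mult_vec Gamma_op_mult_vec inner_add_right inner_commute mult_ac)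
    have Mu: "M *v u = (y \<bullet> u) *\<^sub>R u + y - 2 *\<^sub>R T y"
      unfolding Mv T_def by (simp add: u(2) scaleR_sum_right power2_eq_square mult_ac)
    have uMu: "u \<bullet> (M *v u) = 0"
      unfolding Mu using crit_W[OF yW] u(2) by (simp add: inner_diff_right inner_add_right inner_commute)
    define q where "q = y \<bullet> (M *v u)"
    have q: "q = y \<bullet> y + (u \<bullet> y)\<^sup>2 - 2 * (y \<bullet> T y)"
      unfolding q_def Mu by (simp add: inner_diff_right inner_add_right inner_commute power2_eq_square)
    obtain V :: "real^'k^'n" where V: "P ** (Z ** transpose V + V ** transpose Z) ** P = M"
      "P ** Z *v (u v* V) = M *v u"
      using tangent_solution[OF U u Ru[unfolded R_def P_def] M(1) uMu] unfolding P_def by blast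
    define w where "w = u v* V"
    have "(V ** transpose V) \<bullet> S = \<mu> * (w \<bullet> w)"
      unfolding SM using inner_outer[of u u "V ** transpose V"]
      by (simp add: inner_commute w_def matrix_vector_mul_assoc[symmetric] dot_lmul_matrix)
    moreover have "(Z ** transpose V + V ** transpose Z) \<bullet> X = 2 * q"
    proof -
      have "(Z ** transpose V + V ** transpose Z) \<bullet> X = M \<bullet> X"
        using inner_sandwich[OF U X] V(1) unfolding P_def by metis
      also have "\<dots> = u \<bullet> (M *v y) + y \<bullet> (M *v u)"
        by (simp add: X_def inner_add_right inner_commute[of M] inner_outer)
      also have "u \<bullet> (M *v y) = y \<bullet> (M *v u)"
        using Sym_onD(1)[OF U M(1)] by (metis dot_lmul_matrix inner_commute transpose_matrix_vector)
      finally show ?thesis by (simp add: q_def)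
    qed
    ultimately have wq: "\<mu> * (w \<bullet> w) \<le> q"
      using crit V(1) M(2) unfolding second_order_critical_def Let_def ext_op_def S_def[symmetric] P_def[symmetric]
      by (auto simp: frob_eq_inner dest!: spec[of _ V])
    \<comment> \<open>Since \<open>\<mu> * \<kappa>\<close> is the squared length of
      \<open>?v\<close> and \<open>q = ?v \<bullet> w\<close>, Cauchy-Schwarz together with
      \<open>wq\<close> yields \<open>q \<le> \<kappa>\<close>, from which \<open>w\<close> has
      disappeared.\<close>
    define \<kappa> where "\<kappa> = y \<bullet> T y - (u \<bullet> y)\<^sup>2"
    let ?v = "y v* (P ** Z)"
    have vv: "?v \<bullet> ?v = \<mu> * \<kappa>"
      unfolding dot_lmul_matrix image_W[OF yW] \<kappa>_def
      by (simp add: inner_diff_right inner_commute power2_eq_square)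
    have "q = ?v \<bullet> w" unfolding dot_lmul_matrix w_def V(2) q_def ..
    then have "\<mu> * q\<^sup>2 \<le> (\<mu> * \<kappa>) * (\<mu> * (w \<bullet> w))"
      using Cauchy_Schwarz_ineq[of ?v w] \<mu>0 unfolding vv by (simp add: mult_ac)
    also have "\<dots> \<le> (\<mu> * \<kappa>) * q"
      using wq vv[symmetric] by (intro mult_left_mono) auto
    finally have "q * q \<le> \<kappa> * q" using \<mu>0 by (simp add: power2_eq_square mult_ac)
    moreover have "0 \<le> q" using wq \<mu>0 by (meson inner_ge_zero less_imp_le mult_nonneg_nonneg order_trans)
    moreover have "0 \<le> \<kappa>" using vv \<mu>0 by (metis inner_ge_zero zero_le_mult_iff not_less)
    ultimately have "q \<le> \<kappa>" by (cases "q = 0") auto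
    then show ?thesis unfolding q \<kappa>_def by simp
  qed

  show False
  \<comment> \<open>The positive \<open>\<eta>\<close> makes \<open>r < 1\<close>; this is the
    source of \<open>B < 1\<close> and of the strict bound on each pair of weights.\<close>
  proof (rule no_positive_curvature_plane[where I = "{1..N}" and a = a and r = "1 - \<eta>", OF _ u(2) W dimW])
    show "(\<Sum>i\<in>{1..N}. (a i \<bullet> y)\<^sup>2) \<le> y \<bullet> y" for y
    proof -
      have sumv: "(\<Sum>i\<in>I. outer (a i) (a i)) *v y = (\<Sum>i\<in>I. (a i \<bullet> y) *\<^sub>R a i)" if "finite I" for I
        using that by (induction I rule: finite_induct)
          (auto simp: matrix_vector_mult_add_rdistrib outer_mult_vec)
      have "0 \<le> y \<bullet> ((P - (\<Sum>i=1..N. outer (a i) (a i))) *v y)"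
        using F1 by (simp add: loewner_le_def)
      then have "(\<Sum>i\<in>{1..N}. (a i \<bullet> y)\<^sup>2) \<le> y \<bullet> (P *v y)"
        by (simp add: matrix_vector_mult_diff_rdistrib sumv inner_diff_right inner_sum_right
            power2_eq_square inner_commute)
      also have "\<dots> = (P *v y) \<bullet> (P *v y)"
        using inner_P[of "P *v y" y] by (simp add: matrix_vector_mul_assoc P(2) inner_commute)
      also have "\<dots> \<le> y \<bullet> y"
      proof -
        have "0 \<le> (y - P *v y) \<bullet> (y - P *v y)" by simp
        also have "\<dots> = y \<bullet> y - (P *v y) \<bullet> (P *v y)"
          using inner_P[of "P *v y" y]
          by (simp add: matrix_vector_mul_assoc P(2) inner_diff_left inner_diff_right inner_commute)
        finally show ?thesis by simp
      qed
      finally show ?thesis .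
    qed
    show "a i \<bullet> a i \<le> 1 - \<eta>" if "i \<in> {1..N}" for i using F2[OF that] by (simp add: dot_square_norm)
    show "u \<bullet> y = (\<Sum>i\<in>{1..N}. (a i \<bullet> u)^3 * (a i \<bullet> y))" if "y \<in> W" for y
      unfolding crit_W[OF that] T_inner by (intro sum.cong) (auto simp: power2_eq_square power3_eq_cube)
    show "y \<bullet> y + 2 * (u \<bullet> y)\<^sup>2 \<le> 3 * (\<Sum>i\<in>{1..N}. (a i \<bullet> u)\<^sup>2 * (a i \<bullet> y)\<^sup>2)" if "y \<in> W" for y
      using curv_W[OF that] unfolding T_inner by (simp add: power2_eq_square mult_ac)
  qed (use \<eta> in auto)
qed

theorem theorem6p1:
  fixes U :: "(real^'n) set"
    and L :: "real^'n^'n \<Rightarrow> real^'n^'n"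
    and Zs :: "real^'l^'n"
    and Z :: "real^'k^'n"
  assumes "subspace U"
    and "linear_op_on U L" and "self_adjoint_on U L" and "pos_def_on U L"
    and "structured_inverse U L"
    and "int (dim U) - int CARD('k) = 1"
    and "CARD('k) \<ge> CARD('l) + 1"
    and "second_order_critical U L Zs Z"
  shows "\<forall>W :: real^'k^'n. objective U L Zs Z \<le> objective U L Zs W"
proof
  fix W :: "real^'k^'n"
  have "dim U = CARD('k) + 1" using assms(6) by linarith
  then have "x \<bullet> (slack U L Zs Z *v x) \<le> 0" for x
    using assms by (intro slack_nonpos)
  then show "objective U L Zs Z \<le> objective U L Zs W"
    using assms by (intro optimal_if_slack_nonpos) (auto simp: second_order_critical_def)
qed

end
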